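(* Let $X,Y$ be non-degenerate real random variables with finite expectations whose distributions have no atoms and whose supports are intervals, so that their cdfs $F_X$ and $F_Y$ are strictly increasing and continuous on their supports. Then $X\leq_{disp}Y$ implies $X\leq_{we-disp}Y$.
   Context: $F_X$ is the cumulative distribution function (cdf) of $X$, and $F_X^{-1}$ its inverse (quantile function) on $(0,1)$. Dispersive order: $X\leq_{disp}Y$ (also written $F_X\leq_{disp}F_Y$) means $$F_X^{-1}(v)-F_X^{-1}(u)\leq F_Y^{-1}(v)-F_Y^{-1}(u)\quad\text{for all } 0<u<v<1.$$ Expectiles: for $\alpha\in(0,1)$ and $X$ with finite mean, the $\alpha$-expectile $e_X(\alpha)$ is the unique minimizer over $t\in\mathbb{R}$ of $E[\ell_\alpha(X-t)-\ell_\alpha(X)]$, where $\ell_\alpha(x)=\alpha x^2$ for $x\ge 0$ and $\ell_\alpha(x)=(1-\alpha)x^2$ for $x<0$. Equivalently, $e_X(\alpha)$ is the unique $t\in\mathbb{R}$ solving $\alpha E(X-t)_+=(1-\alpha)E(X-t)_-$, where $x_+=\max\{x,0\}$ and $x_-=\max\{-x,0\}$. Weak expectile dispersive order: $X\leq_{we-disp}Y$ (also written $F_X\leq_{we-disp}F_Y$) means $$e_X(v)-e_X(u)\leq e_Y(v)-e_Y(u)\quad\text{for all } u,v \text{ with } 0<u\leq 1/2\leq v<1.$$ *)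

theory Defs
  imports "HOL-Probability.Probability"
begin

text \<open>Random variables are passed together with their base space, so that the two variables
  compared by an order may live on different probability spaces.\<close>

abbreviation cdf_of :: "'a measure \<Rightarrow> ('a \<Rightarrow> real) \<Rightarrow> real \<Rightarrow> real" where
  "cdf_of M X \<equiv> cdf (distr M borel X)"

text \<open>Only meaningful for \<^term>\<open>p\<close> strictly between 0 and 1; outside, the infimum may be
  taken over an empty or unbounded set.\<close>

definition quantile :: "'a measure \<Rightarrow> ('a \<Rightarrow> real) \<Rightarrow> real \<Rightarrow> real" where
  "quantile M X p = Inf {x. p \<le> cdf_of M X x}"

definition disp_le ::
  "'a measure \<Rightarrow> ('a \<Rightarrow> real) \<Rightarrow> 'b measure \<Rightarrow> ('b \<Rightarrow> real) \<Rightarrow> bool" where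
  "disp_le M X N Y \<longleftrightarrow>
     (\<forall>u v. 0 < u \<and> u < v \<and> v < 1 \<longrightarrow>
        quantile M X v - quantile M X u \<le> quantile N Y v - quantile N Y u)"

definition expectile_loss :: "real \<Rightarrow> real \<Rightarrow> real" where
  "expectile_loss \<alpha> x = (if x \<ge> 0 then \<alpha> * x\<^sup>2 else (1 - \<alpha>) * x\<^sup>2)"

text \<open>Subtracting the loss at \<^term>\<open>X \<omega>\<close> makes the integrand integrable as soon as
  \<^term>\<open>X\<close> is, without a second moment.\<close>

definition expectile :: "'a measure \<Rightarrow> ('a \<Rightarrow> real) \<Rightarrow> real \<Rightarrow> real" where
  "expectile M X \<alpha> =
     (THE t. is_arg_min
        (\<lambda>s. \<integral>\<omega>. (expectile_loss \<alpha> (X \<omega> - s) - expectile_loss \<alpha> (X \<omega>)) \<partial>M) (\<lambda>_. True) t)"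

definition we_disp_le ::
  "'a measure \<Rightarrow> ('a \<Rightarrow> real) \<Rightarrow> 'b measure \<Rightarrow> ('b \<Rightarrow> real) \<Rightarrow> bool" where
  "we_disp_le M X N Y \<longleftrightarrow>
     (\<forall>u v. 0 < u \<and> u \<le> 1/2 \<and> 1/2 \<le> v \<and> v < 1 \<longrightarrow>
        expectile M X v - expectile M X u \<le> expectile N Y v - expectile N Y u)"

definition degenerate :: "'a measure \<Rightarrow> ('a \<Rightarrow> real) \<Rightarrow> bool" where
  "degenerate M X \<longleftrightarrow> (\<exists>c. AE \<omega> in M. X \<omega> = c)"

definition atomless :: "real measure \<Rightarrow> bool" where
  "atomless \<mu> \<longleftrightarrow> (\<forall>x. measure \<mu> {x} = 0)"

text \<open>The topological support, i.e. for a Borel probability measure on the reals the smallest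
  closed set of full measure.\<close>

definition support :: "real measure \<Rightarrow> real set" where
  "support \<mu> = {x. \<forall>U. open U \<and> x \<in> U \<longrightarrow> measure \<mu> U > 0}"

end

theory Submission
  imports Defs
begin

text \<open>
  The weak expectile dispersive order compares expectiles with the mean, which is the expectile at
  level \<open>1/2\<close>: it suffices that \<open>e\<^sub>X(v) - E X \<le> e\<^sub>Y(v) - E Y\<close> for \<open>v \<ge> 1/2\<close> and the reverse for
  \<open>u \<le> 1/2\<close>, since the difference of the two inequalities is the claim.

  These inequalities follow from the dilation order, i.e. the comparison
  \<open>E (X - E X - t)\<^sub>+ \<le> E (Y - E Y - t)\<^sub>+\<close> of the stop-loss transforms of the centred variables.
  Indeed \<open>z\<^sub>- = z\<^sub>+ - z\<close> turns the first-order condition for the expectile into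
  \<open>(2\<alpha> - 1) E (X - t)\<^sub>+ + (1 - \<alpha>) (E X - t) = 0\<close>. The left side strictly decreases in \<open>t\<close> and
  depends on the law of \<open>X\<close> only through the mean and the stop-loss transform, on the latter
  increasingly for \<open>\<alpha> \<ge> 1/2\<close> and decreasingly for \<open>\<alpha> \<le> 1/2\<close>.

  The dispersive order implies the dilation order by a coupling: realise both variables as their
  quantile functions at the same uniform variable. Then the difference of the centred variables is
  a nondecreasing function with mean zero, so its integral over any upper interval, in particular
  over an upper level set of the quantile function of \<open>X\<close>, is nonnegative.
\<close>

section \<open>Expectiles and the first-order condition\<close>

text \<open>Half the derivative of \<^const>\<open>expectile_loss\<close>.\<close>

definition expectile_score :: "real \<Rightarrow> real \<Rightarrow> real" where
  "expectile_score \<alpha> y = (if y \<ge> 0 then \<alpha> * y else (1 - \<alpha>) * y)"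

lemma expectile_score_eq_pos_part:
  "expectile_score \<alpha> y = (2 * \<alpha> - 1) * max y 0 + (1 - \<alpha>) * y"
  by (simp add: expectile_score_def max_def algebra_simps)

lemma expectile_score_measurable [measurable]: "expectile_score \<alpha> \<in> borel_measurable borel"
  unfolding expectile_score_eq_pos_part by measurable

lemma expectile_loss_measurable [measurable]: "expectile_loss \<alpha> \<in> borel_measurable borel"
  unfolding expectile_loss_def by measurable

lemma expectile_score_slope_bounds:
  assumes "0 < \<alpha>" "\<alpha> < 1" "0 \<le> d"
  shows "min \<alpha> (1 - \<alpha>) * d \<le> expectile_score \<alpha> (y + d) - expectile_score \<alpha> y"
    and "expectile_score \<alpha> (y + d) - expectile_score \<alpha> y \<le> d"
proof -
  let ?p = "max (y + d) 0 - max y 0"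
  have p: "0 \<le> ?p" "?p \<le> d" using assms by (auto simp: max_def)
  have eq: "expectile_score \<alpha> (y + d) - expectile_score \<alpha> y = \<alpha> * ?p + (1 - \<alpha>) * (d - ?p)"
    by (simp add: expectile_score_eq_pos_part algebra_simps)
  have "min \<alpha> (1 - \<alpha>) * ?p + min \<alpha> (1 - \<alpha>) * (d - ?p) \<le> \<alpha> * ?p + (1 - \<alpha>) * (d - ?p)"
    using p by (intro add_mono mult_right_mono) auto
  then show "min \<alpha> (1 - \<alpha>) * d \<le> expectile_score \<alpha> (y + d) - expectile_score \<alpha> y"
    unfolding eq by (simp add: algebra_simps)
  have "\<alpha> * ?p + (1 - \<alpha>) * (d - ?p) \<le> 1 * ?p + 1 * (d - ?p)"
    using p assms by (intro add_mono mult_right_mono) auto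
  then show "expectile_score \<alpha> (y + d) - expectile_score \<alpha> y \<le> d"
    unfolding eq by simp
qed

text \<open>The second-order remainder of the loss lies between two parabolas because the second
  derivative of the loss, where it exists, is twice \<open>\<alpha>\<close> or twice \<open>1 - \<alpha>\<close>. The lower bound
  gives strict convexity, the upper one integrability.\<close>

lemma expectile_loss_remainder_bounds:
  assumes "0 < \<alpha>" "\<alpha> < 1"
  shows "min \<alpha> (1 - \<alpha>) * d\<^sup>2 \<le>
           expectile_loss \<alpha> (y - d) - expectile_loss \<alpha> y + 2 * d * expectile_score \<alpha> y"
    and "expectile_loss \<alpha> (y - d) - expectile_loss \<alpha> y + 2 * d * expectile_score \<alpha> y \<le> d\<^sup>2"
proof -
  let ?R = "expectile_loss \<alpha> (y - d) - expectile_loss \<alpha> y + 2 * d * expectile_score \<alpha> y"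
  \<comment> \<open>The remainder is \<open>\<alpha> * d\<^sup>2\<close> or \<open>(1 - \<alpha>) * d\<^sup>2\<close> if both arguments have the same sign; otherwise
    it is a mixture of the two with weight \<open>q / d\<^sup>2\<close> on the first.\<close>
  have "\<exists>q. 0 \<le> q \<and> q \<le> d\<^sup>2 \<and> ?R = \<alpha> * q + (1 - \<alpha>) * (d\<^sup>2 - q)"
  proof -
    consider "y \<ge> 0" "y - d \<ge> 0" | "y < 0" "y - d < 0" | "y \<ge> 0" "y - d < 0" | "y < 0" "y - d \<ge> 0"
      by linarith
    then show ?thesis
    proof cases
      case 1
      then show ?thesis
        by (intro exI[of _ "d\<^sup>2"])
          (simp add: expectile_loss_def expectile_score_def power2_eq_square algebra_simps)
    next
      case 2
      then show ?thesis
        by (intro exI[of _ 0])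
          (simp add: expectile_loss_def expectile_score_def power2_eq_square algebra_simps)
    next
      case 3
      have "(y - d)\<^sup>2 \<le> d\<^sup>2" using 3 by (intro abs_le_square_iff[THEN iffD1]) auto
      then show ?thesis using 3 zero_le_power2[of "y - d"]
        by (intro exI[of _ "d\<^sup>2 - (y - d)\<^sup>2"])
          (simp add: expectile_loss_def expectile_score_def power2_eq_square algebra_simps)
    next
      case 4
      have "(y - d)\<^sup>2 \<le> d\<^sup>2" using 4 by (intro abs_le_square_iff[THEN iffD1]) auto
      then show ?thesis using 4 zero_le_power2[of "y - d"]
        by (intro exI[of _ "(y - d)\<^sup>2"])
          (simp add: expectile_loss_def expectile_score_def power2_eq_square algebra_simps)
    qed
  qed
  then obtain q where q: "0 \<le> q" "q \<le> d\<^sup>2" and R: "?R = \<alpha> * q + (1 - \<alpha>) * (d\<^sup>2 - q)"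
    by blast
  have "min \<alpha> (1 - \<alpha>) * q + min \<alpha> (1 - \<alpha>) * (d\<^sup>2 - q) \<le> \<alpha> * q + (1 - \<alpha>) * (d\<^sup>2 - q)"
    using q by (intro add_mono mult_right_mono) auto
  then show "min \<alpha> (1 - \<alpha>) * d\<^sup>2 \<le> ?R"
    unfolding R by (simp add: algebra_simps)
  have "\<alpha> * q + (1 - \<alpha>) * (d\<^sup>2 - q) \<le> 1 * q + 1 * (d\<^sup>2 - q)"
    using q assms by (intro add_mono mult_right_mono) auto
  then show "?R \<le> d\<^sup>2" unfolding R by simp
qed

context prob_space
begin

context
  fixes X :: "'a \<Rightarrow> real" and \<alpha> :: real
  assumes X: "integrable M X" and \<alpha>: "0 < \<alpha>" "\<alpha> < 1"
begin

lemma integrable_expectile_score: "integrable M (\<lambda>\<omega>. expectile_score \<alpha> (X \<omega> - t))"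
  unfolding expectile_score_eq_pos_part using X by auto

lemma expectation_expectile_score:
  "expectation (\<lambda>\<omega>. expectile_score \<alpha> (X \<omega> - t)) =
     (2 * \<alpha> - 1) * expectation (\<lambda>\<omega>. max (X \<omega> - t) 0) + (1 - \<alpha>) * (expectation X - t)"
  unfolding expectile_score_eq_pos_part using X by (simp add: prob_space)

lemma expectation_expectile_score_slope_bounds:
  assumes "s \<le> t"
  shows "min \<alpha> (1 - \<alpha>) * (t - s) \<le>
           expectation (\<lambda>\<omega>. expectile_score \<alpha> (X \<omega> - s))
           - expectation (\<lambda>\<omega>. expectile_score \<alpha> (X \<omega> - t))"
    and "expectation (\<lambda>\<omega>. expectile_score \<alpha> (X \<omega> - s))
           - expectation (\<lambda>\<omega>. expectile_score \<alpha> (X \<omega> - t)) \<le> t - s"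
proof -
  note int = integrable_expectile_score
  have eq: "expectation (\<lambda>\<omega>. expectile_score \<alpha> (X \<omega> - s))
           - expectation (\<lambda>\<omega>. expectile_score \<alpha> (X \<omega> - t)) =
        expectation (\<lambda>\<omega>. expectile_score \<alpha> (X \<omega> - s) - expectile_score \<alpha> (X \<omega> - t))"
    by (simp add: int)
  have bounds: "min \<alpha> (1 - \<alpha>) * (t - s) \<le> expectile_score \<alpha> (X \<omega> - s) - expectile_score \<alpha> (X \<omega> - t)"
    "expectile_score \<alpha> (X \<omega> - s) - expectile_score \<alpha> (X \<omega> - t) \<le> t - s" for \<omega>
    using expectile_score_slope_bounds[OF \<alpha>, of "t - s" "X \<omega> - t"] assms by auto
  show "min \<alpha> (1 - \<alpha>) * (t - s) \<le> expectation (\<lambda>\<omega>. expectile_score \<alpha> (X \<omega> - s))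
           - expectation (\<lambda>\<omega>. expectile_score \<alpha> (X \<omega> - t))"
    unfolding eq using bounds(1) by (intro integral_ge_const) (auto simp: int)
  show "expectation (\<lambda>\<omega>. expectile_score \<alpha> (X \<omega> - s))
           - expectation (\<lambda>\<omega>. expectile_score \<alpha> (X \<omega> - t)) \<le> t - s"
    unfolding eq using bounds(2) by (intro integral_le_const) (auto simp: int)
qed

text \<open>The expected score is Lipschitz in \<open>t\<close> and decreases at least at a fixed linear rate, so
  the intermediate value theorem applies.\<close>

lemma expectation_expectile_score_root:
  obtains t where "expectation (\<lambda>\<omega>. expectile_score \<alpha> (X \<omega> - t)) = 0"
proof -
  define g where "g t = expectation (\<lambda>\<omega>. expectile_score \<alpha> (X \<omega> - t))" for t
  define m where "m = min \<alpha> (1 - \<alpha>)"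
  have m: "m > 0" using \<alpha> by (simp add: m_def)
  have low: "m * (t - s) \<le> g s - g t" and up: "g s - g t \<le> t - s" if "s \<le> t" for s t
    using expectation_expectile_score_slope_bounds[OF that] by (auto simp: g_def m_def)
  have lip: "\<bar>g s - g t\<bar> \<le> \<bar>s - t\<bar>" for s t
  proof (cases "s \<le> t")
    case True
    moreover have "0 \<le> m * (t - s)" using m True by simp
    ultimately show ?thesis using low[of s t] up[of s t] by linarith
  next
    case False
    moreover have "0 \<le> m * (s - t)" using m False by simp
    ultimately show ?thesis using low[of t s] up[of t s] by linarith
  qed
  have cont: "continuous_on A g" for A
    by (rule lipschitz_on_continuous_on[where L = 1])
      (use lip in \<open>auto intro!: lipschitz_onI simp: dist_real_def\<close>)
  \<comment> \<open>At the decay rate \<open>m\<close>, the sign of \<open>g\<close> changes within distance \<open>\<bar>g 0\<bar> / m\<close> of \<open>0\<close>.\<close>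
  let ?r = "\<bar>g 0\<bar> / m"
  have r: "0 \<le> ?r" using m by simp
  have "g ?r \<le> 0" using low[OF r] m by simp
  moreover have "0 \<le> g (- ?r)" using low[of "- ?r" 0] r m by simp
  ultimately obtain t where "g t = 0"
    using IVT2'[of g ?r 0 "- ?r"] cont r by auto
  then show thesis using that by (simp add: g_def)
qed

text \<open>By the lower remainder bound, moving away from a root of the expected score by \<open>s - t\<close>
  increases the expected loss by at least a positive multiple of \<open>(s - t)\<^sup>2\<close>. Hence the root is the
  only minimiser.\<close>

lemma expectile_eqI:
  assumes root: "expectation (\<lambda>\<omega>. expectile_score \<alpha> (X \<omega> - t)) = 0"
  shows "expectile M X \<alpha> = t"
proof -
  let ?L = "\<lambda>s \<omega>. expectile_loss \<alpha> (X \<omega> - s) - expectile_loss \<alpha> (X \<omega>)"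
  let ?m = "min \<alpha> (1 - \<alpha>)"
  have [measurable]: "X \<in> borel_measurable M" using X by auto
  note int = integrable_expectile_score
  have intL: "integrable M (?L s)" for s
  proof -
    let ?R = "\<lambda>\<omega>. ?L s \<omega> + 2 * s * expectile_score \<alpha> (X \<omega>)"
    have "\<bar>?R \<omega>\<bar> \<le> s\<^sup>2" for \<omega>
    proof -
      have "0 \<le> ?m * s\<^sup>2" using \<alpha> by simp
      then show ?thesis
        using expectile_loss_remainder_bounds[OF \<alpha>, where d = s and y = "X \<omega>"] by linarith
    qed
    then have "integrable M ?R"
      by (intro integrable_const_bound[where B = "s\<^sup>2"]) auto
    moreover have "integrable M (\<lambda>\<omega>. 2 * s * expectile_score \<alpha> (X \<omega>))"
      using int[of 0] by simp
    ultimately have "integrable M (\<lambda>\<omega>. ?R \<omega> - 2 * s * expectile_score \<alpha> (X \<omega>))"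
      by (rule Bochner_Integration.integrable_diff)
    then show ?thesis by simp
  qed
  have growth: "expectation (?L t) + ?m * (s - t)\<^sup>2 \<le> expectation (?L s)" for s
  proof -
    have "?m * (s - t)\<^sup>2 \<le>
      expectation (\<lambda>\<omega>. ?L s \<omega> - ?L t \<omega> + 2 * (s - t) * expectile_score \<alpha> (X \<omega> - t))"
      using expectile_loss_remainder_bounds(1)[OF \<alpha>, where d = "s - t" and y = "X _ - t"]
      by (intro integral_ge_const Bochner_Integration.integrable_add
          Bochner_Integration.integrable_diff intL integrable_mult_right int AE_I2) simp
    also have "\<dots> = expectation (\<lambda>\<omega>. ?L s \<omega> - ?L t \<omega>)
        + expectation (\<lambda>\<omega>. 2 * (s - t) * expectile_score \<alpha> (X \<omega> - t))"
      by (intro Bochner_Integration.integral_add Bochner_Integration.integrable_diff intL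
          integrable_mult_right int)
    also have "\<dots> = expectation (?L s) - expectation (?L t)"
      by (subst Bochner_Integration.integral_diff[OF intL intL]) (simp add: root)
    finally show ?thesis by simp
  qed
  show ?thesis unfolding expectile_def
  proof (rule the_equality)
    have "expectation (?L t) \<le> expectation (?L s)" for s
    proof -
      have "0 \<le> ?m * (s - t)\<^sup>2" using \<alpha> by simp
      then show ?thesis using growth[of s] by linarith
    qed
    then show "is_arg_min (\<lambda>s. expectation (?L s)) (\<lambda>_. True) t"
      by (simp add: is_arg_min_linorder)
  next
    fix s assume "is_arg_min (\<lambda>s. expectation (?L s)) (\<lambda>_. True) s"
    then have "expectation (?L s) \<le> expectation (?L t)"
      by (simp add: is_arg_min_linorder)
    then have "?m * (s - t)\<^sup>2 \<le> 0" using growth[of s] by linarith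
    then show "s = t" using \<alpha> by (auto simp: mult_le_0_iff min_le_iff_disj)
  qed
qed

lemma expectation_expectile_score_expectile:
  "expectation (\<lambda>\<omega>. expectile_score \<alpha> (X \<omega> - expectile M X \<alpha>)) = 0"
  using expectation_expectile_score_root expectile_eqI by metis

lemma le_expectile_iff:
  "t \<le> expectile M X \<alpha> \<longleftrightarrow> 0 \<le> expectation (\<lambda>\<omega>. expectile_score \<alpha> (X \<omega> - t))"
proof (cases "t \<le> expectile M X \<alpha>")
  case True
  have "0 \<le> min \<alpha> (1 - \<alpha>) * (expectile M X \<alpha> - t)" using \<alpha> True by simp
  then show ?thesis
    using True expectation_expectile_score_slope_bounds(1)[OF True]
      expectation_expectile_score_expectile by simp
next
  case False
  have "0 < min \<alpha> (1 - \<alpha>) * (t - expectile M X \<alpha>)" using \<alpha> False by simp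
  then show ?thesis
    using False expectation_expectile_score_slope_bounds(1)[of "expectile M X \<alpha>" t]
      expectation_expectile_score_expectile by simp
qed

lemma expectile_le_iff:
  "expectile M X \<alpha> \<le> t \<longleftrightarrow> expectation (\<lambda>\<omega>. expectile_score \<alpha> (X \<omega> - t)) \<le> 0"
proof (cases "expectile M X \<alpha> \<le> t")
  case True
  have "0 \<le> min \<alpha> (1 - \<alpha>) * (t - expectile M X \<alpha>)" using \<alpha> True by simp
  then show ?thesis
    using True expectation_expectile_score_slope_bounds(1)[OF True]
      expectation_expectile_score_expectile by simp
next
  case False
  have "0 < min \<alpha> (1 - \<alpha>) * (expectile M X \<alpha> - t)" using \<alpha> False by simp
  then show ?thesis
    using False expectation_expectile_score_slope_bounds(1)[of t "expectile M X \<alpha>"]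
      expectation_expectile_score_expectile by simp
qed

end

end

section \<open>From the dispersive order to the dilation order\<close>

abbreviation unit_uniform :: "real measure" where
  "unit_uniform \<equiv> restrict_space lborel {0<..<1}"

lemma prob_space_unit_uniform: "prob_space unit_uniform"
  by (auto simp: space_restrict_space emeasure_restrict_space intro!: prob_spaceI)

lemma
  assumes "prob_space M" and [measurable]: "X \<in> borel_measurable M"
  shows mono_on_quantile: "mono_on {0<..<1} (quantile M X)"
    and borel_measurable_quantile: "quantile M X \<in> borel_measurable unit_uniform"
    and distr_quantile: "distr unit_uniform borel (quantile M X) = distr M borel X"
proof -
  interpret cdf_distribution "distr M borel X"
    unfolding cdf_distribution_def
    using assms by (rule prob_space.real_distribution_distr)
  have eq: "quantile M X = I" by (simp add: quantile_def fun_eq_iff)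
  show "mono_on {0<..<1} (quantile M X)" unfolding eq by (rule mono_I)
  show "quantile M X \<in> borel_measurable unit_uniform"
    unfolding eq using measurable_CI by (simp cong: measurable_cong_sets)
  show "distr unit_uniform borel (quantile M X) = distr M borel X"
    unfolding eq by (rule distr_I_eq_M)
qed

lemma
  fixes f :: "real \<Rightarrow> real"
  assumes "prob_space M" and [measurable]: "X \<in> borel_measurable M" "f \<in> borel_measurable borel"
  shows integrable_quantile_iff:
      "integrable unit_uniform (\<lambda>p. f (quantile M X p)) \<longleftrightarrow> integrable M (\<lambda>\<omega>. f (X \<omega>))"
    and integral_quantile:
      "(\<integral>p. f (quantile M X p) \<partial>unit_uniform) = (\<integral>\<omega>. f (X \<omega>) \<partial>M)"
proof -
  note [measurable] = borel_measurable_quantile[OF assms(1,2)]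
  show "integrable unit_uniform (\<lambda>p. f (quantile M X p)) \<longleftrightarrow> integrable M (\<lambda>\<omega>. f (X \<omega>))"
    using integrable_distr_eq[of "quantile M X" unit_uniform borel f]
      integrable_distr_eq[of X M borel f] distr_quantile[OF assms(1,2)] by simp
  show "(\<integral>p. f (quantile M X p) \<partial>unit_uniform) = (\<integral>\<omega>. f (X \<omega>) \<partial>M)"
    using integral_distr[of "quantile M X" unit_uniform borel f]
      integral_distr[of X M borel f] distr_quantile[OF assms(1,2)] by simp
qed

text \<open>If \<open>h\<close> is nonnegative on the upper set \<open>A\<close>, so is the integral over \<open>A\<close>. Otherwise \<open>h\<close> is
  negative at some point of \<open>A\<close>, hence everywhere outside \<open>A\<close>, and dropping the complement of \<open>A\<close>
  from the integral over the whole space only increases it.\<close>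

lemma integral_mono_on_upper_set_nonneg:
  fixes \<mu> :: "real measure" and h :: "real \<Rightarrow> real"
  assumes h: "integrable \<mu> h" "mono_on (space \<mu>) h" "0 \<le> (\<integral>x. h x \<partial>\<mu>)"
    and A: "A \<in> sets \<mu>" "\<And>x y. x \<in> A \<Longrightarrow> y \<in> space \<mu> \<Longrightarrow> x \<le> y \<Longrightarrow> y \<in> A"
  shows "0 \<le> (\<integral>x. indicator A x * h x \<partial>\<mu>)"
proof (cases "\<forall>x\<in>A. 0 \<le> h x")
  case True
  then show ?thesis by (intro integral_nonneg_AE AE_I2) (simp add: indicator_def)
next
  case False
  then obtain a where a: "a \<in> A" "h a < 0" by force
  have "a \<in> space \<mu>" using a A(1) sets.sets_into_space by blast
  have "h x \<le> indicator A x * h x" if "x \<in> space \<mu>" for x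
  proof (cases "x \<in> A")
    case False
    then have "x \<le> a" using A(2)[OF a(1) that] by linarith
    then have "h x \<le> h a" using h(2) that \<open>a \<in> space \<mu>\<close> by (simp add: mono_on_def)
    then show ?thesis using False a by simp
  qed simp
  then have "(\<integral>x. h x \<partial>\<mu>) \<le> (\<integral>x. indicator A x * h x \<partial>\<mu>)"
    using h(1) A(1)
    by (intro integral_mono integrable_mult_indicator[where 'b = real, simplified]) auto
  then show ?thesis using h(3) by linarith
qed

text \<open>With \<open>W\<close> and \<open>Z\<close> the centred quantile functions, \<open>Z\<^sub>+ - W\<^sub>+ \<ge> (Z - W) 1\<^bsub>W > 0\<^esub>\<close> and its analogue
  at level \<open>t\<close> reduce the claim to the positivity of the integral of the nondecreasing mean-zero
  function \<open>Z - W\<close> over an upper set.\<close>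

lemma disp_le_imp_stop_loss_le:
  assumes M: "prob_space M" and N: "prob_space N"
    and X: "integrable M X" and Y: "integrable N Y"
    and disp: "disp_le M X N Y"
  shows "(\<integral>\<omega>. max (X \<omega> - (\<integral>\<omega>. X \<omega> \<partial>M) - t) 0 \<partial>M) \<le>
         (\<integral>\<omega>. max (Y \<omega> - (\<integral>\<omega>. Y \<omega> \<partial>N) - t) 0 \<partial>N)"
proof -
  interpret M: prob_space M by fact
  interpret N: prob_space N by fact
  interpret U: prob_space unit_uniform by (rule prob_space_unit_uniform)
  have Xm: "X \<in> borel_measurable M" and Ym: "Y \<in> borel_measurable N" using X Y by auto
  note iX = integral_quantile[OF M Xm] and iY = integral_quantile[OF N Ym]
  define W where "W p = quantile M X p - (\<integral>\<omega>. X \<omega> \<partial>M)" for p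
  define Z where "Z p = quantile N Y p - (\<integral>\<omega>. Y \<omega> \<partial>N)" for p
  define A where "A = {p \<in> space unit_uniform. t < W p}"
  have space: "space unit_uniform = {0<..<1}" by (simp add: space_restrict_space)
  have intQ: "integrable unit_uniform (quantile M X)" "integrable unit_uniform (quantile N Y)"
    using integrable_quantile_iff[OF M Xm, of "\<lambda>x. x"] integrable_quantile_iff[OF N Ym, of "\<lambda>x. x"]
      X Y by simp_all
  have intW: "integrable unit_uniform W" and intZ: "integrable unit_uniform Z"
    unfolding W_def Z_def using intQ by auto
  have [measurable]: "W \<in> borel_measurable unit_uniform" using intW by auto
  have A: "A \<in> sets unit_uniform" unfolding A_def by measurable
  have "(\<integral>p. W p \<partial>unit_uniform) = 0" "(\<integral>p. Z p \<partial>unit_uniform) = 0"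
    unfolding W_def Z_def using iX[of "\<lambda>x. x"] iY[of "\<lambda>x. x"] intQ
      U.prob_space[unfolded space] by (simp_all add: space)
  then have mean: "0 \<le> (\<integral>p. (Z p - W p) \<partial>unit_uniform)"
    using intW intZ by simp
  have mono: "mono_on (space unit_uniform) (\<lambda>p. Z p - W p)"
  proof (rule mono_onI)
    fix r s :: real
    assume rs: "r \<in> space unit_uniform" "s \<in> space unit_uniform" "r \<le> s"
    show "Z r - W r \<le> Z s - W s"
    proof (cases "r = s")
      case False
      then have "quantile M X s - quantile M X r \<le> quantile N Y s - quantile N Y r"
        using disp rs unfolding disp_le_def space by auto
      then show ?thesis unfolding W_def Z_def by linarith
    qed simp
  qed
  have upper: "s \<in> A" if "r \<in> A" "s \<in> space unit_uniform" "r \<le> s" for r s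
  proof -
    have "quantile M X r \<le> quantile M X s"
      using mono_on_quantile[OF M Xm] that unfolding A_def space by (auto simp: mono_on_def)
    then show ?thesis using that unfolding A_def W_def by simp
  qed
  have "0 \<le> (\<integral>p. indicator A p * (Z p - W p) \<partial>unit_uniform)"
    using integral_mono_on_upper_set_nonneg[OF _ mono mean A upper] intW intZ by simp
  also have "\<dots> \<le> (\<integral>p. max (Z p - t) 0 - max (W p - t) 0 \<partial>unit_uniform)"
    using intW intZ A
    by (intro integral_mono integrable_mult_indicator[where 'b = real, simplified]
        Bochner_Integration.integrable_diff integrable_max)
      (auto simp: A_def indicator_def)
  also have "\<dots> = (\<integral>p. max (Z p - t) 0 \<partial>unit_uniform) - (\<integral>p. max (W p - t) 0 \<partial>unit_uniform)"
    using intW intZ by (intro Bochner_Integration.integral_diff integrable_max) auto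
  finally have "(\<integral>p. max (W p - t) 0 \<partial>unit_uniform) \<le> (\<integral>p. max (Z p - t) 0 \<partial>unit_uniform)"
    by simp
  then show ?thesis
    unfolding W_def Z_def
    using iX[of "\<lambda>x. max (x - (\<integral>\<omega>. X \<omega> \<partial>M) - t) 0"] iY[of "\<lambda>x. max (x - (\<integral>\<omega>. Y \<omega> \<partial>N) - t) 0"]
    by simp
qed

section \<open>Comparison of expectiles under the dilation order\<close>

context
  fixes M :: "'a measure" and N :: "'b measure" and X :: "'a \<Rightarrow> real" and Y :: "'b \<Rightarrow> real"
  assumes M: "prob_space M" and N: "prob_space N"
    and X: "integrable M X" and Y: "integrable N Y"
    and stop_loss: "\<And>t. (\<integral>\<omega>. max (X \<omega> - (\<integral>\<omega>. X \<omega> \<partial>M) - t) 0 \<partial>M) \<le>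
         (\<integral>\<omega>. max (Y \<omega> - (\<integral>\<omega>. Y \<omega> \<partial>N) - t) 0 \<partial>N)"
begin

lemma centred_expectile_mono:
  assumes "1/2 \<le> \<alpha>" "\<alpha> < 1"
  shows "expectile M X \<alpha> - (\<integral>\<omega>. X \<omega> \<partial>M) \<le> expectile N Y \<alpha> - (\<integral>\<omega>. Y \<omega> \<partial>N)"
proof -
  interpret M: prob_space M by fact
  interpret N: prob_space N by fact
  have \<alpha>: "0 < \<alpha>" "\<alpha> < 1" using assms by auto
  define c where "c = expectile M X \<alpha> - (\<integral>\<omega>. X \<omega> \<partial>M)"
  have "0 = (\<integral>\<omega>. expectile_score \<alpha> (X \<omega> - ((\<integral>\<omega>. X \<omega> \<partial>M) + c)) \<partial>M)"
    using M.expectation_expectile_score_expectile[OF X \<alpha>] by (simp add: c_def)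
  also have "\<dots> \<le> (\<integral>\<omega>. expectile_score \<alpha> (Y \<omega> - ((\<integral>\<omega>. Y \<omega> \<partial>N) + c)) \<partial>N)"
    unfolding M.expectation_expectile_score[OF X \<alpha>] N.expectation_expectile_score[OF Y \<alpha>]
    using mult_left_mono[OF stop_loss[of c], of "2 * \<alpha> - 1"] assms(1)
    by (simp add: diff_diff_eq)
  finally have "(\<integral>\<omega>. Y \<omega> \<partial>N) + c \<le> expectile N Y \<alpha>"
    using N.le_expectile_iff[OF Y \<alpha>] by blast
  then show ?thesis unfolding c_def by linarith
qed

lemma centred_expectile_antimono:
  assumes "0 < \<alpha>" "\<alpha> \<le> 1/2"
  shows "expectile N Y \<alpha> - (\<integral>\<omega>. Y \<omega> \<partial>N) \<le> expectile M X \<alpha> - (\<integral>\<omega>. X \<omega> \<partial>M)"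
proof -
  interpret M: prob_space M by fact
  interpret N: prob_space N by fact
  have \<alpha>: "0 < \<alpha>" "\<alpha> < 1" using assms by auto
  define c where "c = expectile M X \<alpha> - (\<integral>\<omega>. X \<omega> \<partial>M)"
  have "(\<integral>\<omega>. expectile_score \<alpha> (Y \<omega> - ((\<integral>\<omega>. Y \<omega> \<partial>N) + c)) \<partial>N) \<le>
      (\<integral>\<omega>. expectile_score \<alpha> (X \<omega> - ((\<integral>\<omega>. X \<omega> \<partial>M) + c)) \<partial>M)"
    unfolding M.expectation_expectile_score[OF X \<alpha>] N.expectation_expectile_score[OF Y \<alpha>]
    using mult_left_mono_neg[OF stop_loss[of c], of "2 * \<alpha> - 1"] assms(2)
    by (simp add: diff_diff_eq)
  also have "\<dots> = 0"
    using M.expectation_expectile_score_expectile[OF X \<alpha>] by (simp add: c_def)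
  finally have "expectile N Y \<alpha> \<le> (\<integral>\<omega>. Y \<omega> \<partial>N) + c"
    using N.expectile_le_iff[OF Y \<alpha>] by blast
  then show ?thesis unfolding c_def by linarith
qed

end

theorem corollary11:
  fixes M :: "'a measure" and N :: "'b measure"
    and X :: "'a \<Rightarrow> real" and Y :: "'b \<Rightarrow> real"
  assumes "prob_space M" and "prob_space N"
    and "integrable M X" and "integrable N Y"
    and "\<not> degenerate M X" and "\<not> degenerate N Y"
    and "atomless (distr M borel X)" and "atomless (distr N borel Y)"
    and "is_interval (support (distr M borel X))"
    and "is_interval (support (distr N borel Y))"
    and "disp_le M X N Y"
  shows "we_disp_le M X N Y"
proof -
  note stop_loss = disp_le_imp_stop_loss_le[OF assms(1-4,11)]
  show ?thesis
    unfolding we_disp_le_def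
  proof (intro allI impI)
    fix u v :: real
    assume uv: "0 < u \<and> u \<le> 1/2 \<and> 1/2 \<le> v \<and> v < 1"
    have "expectile M X v - (\<integral>\<omega>. X \<omega> \<partial>M) \<le> expectile N Y v - (\<integral>\<omega>. Y \<omega> \<partial>N)"
      using uv by (intro centred_expectile_mono[OF assms(1-4) stop_loss]) auto
    moreover have "expectile N Y u - (\<integral>\<omega>. Y \<omega> \<partial>N) \<le> expectile M X u - (\<integral>\<omega>. X \<omega> \<partial>M)"
      using uv by (intro centred_expectile_antimono[OF assms(1-4) stop_loss]) auto
    ultimately show "expectile M X v - expectile M X u \<le> expectile N Y v - expectile N Y u"
      by linarith
  qed
qed

end
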